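(* Let $H$ be a forest and let $\epsilon>0$. There exists $N(H,\epsilon)$ such that for every $n>N(H,\epsilon)$, in the $(1:b)$ biased $H$-minor game on $K_n$ with bias $b=(1-\epsilon)n$, Maker has a winning strategy.
   Context: A $(1:b)$ biased Maker–Breaker game on $K_n$ is played on the board $E(K_n)$: in each round Maker claims one unclaimed edge and then Breaker claims $b$ unclaimed edges (fewer if fewer remain), until all edges are claimed. $M$ denotes Maker's graph at the end. In the $H$-minor game Maker wins iff $H$ is a minor of $M$ (i.e. there exist pairwise disjoint non-empty sets $S_v\subseteq V(M)$, $v\in V(H)$, each inducing a connected subgraph of $M$, with an edge of $M$ between $S_v$ and $S_w$ whenever $vw\in E(H)$); otherwise Breaker wins. *)

theory Defs
  imports Complex_Main "HOL-Library.Ramsey" "HOL-Library.Disjoint_Sets"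
begin

section \<open>Graphs\<close>

text \<open>A finite simple graph is a finite vertex set together with a set of two-element subsets of it;
  \<open>nsets V 2\<close> is the set of all of these, so \<open>nsets {..<n} 2\<close> is the edge set of the complete graph
  on \<open>n\<close> vertices.\<close>

definition simple_graph :: "'a set \<Rightarrow> 'a set set \<Rightarrow> bool" where
  "simple_graph V E \<longleftrightarrow> finite V \<and> E \<subseteq> nsets V 2"

definition is_cycle :: "'a set set \<Rightarrow> 'a list \<Rightarrow> bool" where
  "is_cycle E vs \<longleftrightarrow> length vs \<ge> 3 \<and> distinct vs \<and>
     (\<forall>i<length vs. {vs ! i, vs ! ((i + 1) mod length vs)} \<in> E)"

definition forest :: "'a set \<Rightarrow> 'a set set \<Rightarrow> bool" where
  "forest V E \<longleftrightarrow> simple_graph V E \<and> (\<nexists>vs. is_cycle E vs)"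

definition induces_connected :: "'a set set \<Rightarrow> 'a set \<Rightarrow> bool" where
  "induces_connected E S \<longleftrightarrow>
     (\<forall>x\<in>S. \<forall>y\<in>S. (x, y) \<in> {(u, v). u \<in> S \<and> v \<in> S \<and> {u, v} \<in> E}\<^sup>*)"

definition is_minor :: "'a set \<Rightarrow> 'a set set \<Rightarrow> 'b set \<Rightarrow> 'b set set \<Rightarrow> bool" where
  "is_minor VH EH VM EM \<longleftrightarrow>
     (\<exists>S :: 'a \<Rightarrow> 'b set.
        (\<forall>v\<in>VH. S v \<noteq> {} \<and> S v \<subseteq> VM \<and> induces_connected EM (S v)) \<and>
        disjoint_family_on S VH \<and>
        (\<forall>v\<in>VH. \<forall>w\<in>VH. {v, w} \<in> EH \<longrightarrow> (\<exists>x\<in>S v. \<exists>y\<in>S w. {x, y} \<in> EM)))"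


section \<open>Biased Maker--Breaker games\<close>

text \<open>A history is the list of the completed rounds, oldest first. A round consists of the element
  claimed by Maker and the set of elements that Breaker claims in reply.\<close>

type_synonym 'e history = "('e \<times> 'e set) list"

definition maker_claimed :: "'e history \<Rightarrow> 'e set" where
  "maker_claimed h = fst ` set h"

definition breaker_claimed :: "'e history \<Rightarrow> 'e set" where
  "breaker_claimed h = \<Union> (snd ` set h)"

definition unclaimed :: "'e set \<Rightarrow> 'e history \<Rightarrow> 'e set" where
  "unclaimed X h = X - (maker_claimed h \<union> breaker_claimed h)"

text \<open>The histories that can arise in the \<open>(1:b)\<close> game on the finite board \<open>X\<close> when Maker follows the
  strategy \<open>\<sigma>\<close> and Breaker plays arbitrarily. Breaker takes exactly \<open>b\<close> elements, or all the
  remaining ones if there are fewer than \<open>b\<close>.\<close>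

inductive reachable :: "'e set \<Rightarrow> nat \<Rightarrow> ('e history \<Rightarrow> 'e) \<Rightarrow> 'e history \<Rightarrow> bool"
  for X :: "'e set" and b :: nat and \<sigma> :: "'e history \<Rightarrow> 'e" where
  start: "reachable X b \<sigma> []"
| round: "\<lbrakk>reachable X b \<sigma> h; \<sigma> h \<in> unclaimed X h;
           F \<subseteq> unclaimed X h - {\<sigma> h}; card F = min b (card (unclaimed X h - {\<sigma> h}))\<rbrakk>
          \<Longrightarrow> reachable X b \<sigma> (h @ [(\<sigma> h, F)])"

text \<open>A winning strategy must always prescribe a legal move while the game is not over, and Maker's
  final set must satisfy \<open>W\<close> once every element has been claimed.\<close>

definition maker_winning_strategy ::
  "'e set \<Rightarrow> nat \<Rightarrow> ('e set \<Rightarrow> bool) \<Rightarrow> ('e history \<Rightarrow> 'e) \<Rightarrow> bool" where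
  "maker_winning_strategy X b W \<sigma> \<longleftrightarrow>
     (\<forall>h. reachable X b \<sigma> h \<longrightarrow>
        (if unclaimed X h = {} then W (maker_claimed h) else \<sigma> h \<in> unclaimed X h))"

definition maker_wins_minor_game :: "'a set \<Rightarrow> 'a set set \<Rightarrow> nat \<Rightarrow> nat \<Rightarrow> bool" where
  "maker_wins_minor_game VH EH n b \<longleftrightarrow>
     (\<exists>\<sigma>. maker_winning_strategy (nsets {..<n} 2) b (is_minor VH EH {..<n}) \<sigma>)"

end

theory Submission
  imports Defs "HOL-Real_Asymp.Real_Asymp"
begin

text \<open>Maker grows a single tree, always joining one of its vertices to a fresh vertex of small Breaker
  degree. Label the starting vertex 0; when \<open>u\<close> is attached to \<open>v\<close>, both get the label of \<open>v\<close> plus one.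
  Maker extends a vertex of least label among those that still see many fresh vertices. A move
  creates about \<open>n\<close> new free edges, Breaker destroys at most \<open>(1 - \<epsilon>) n\<close>, so with
  \<open>q = 1 - \<epsilon>/4\<close> the sum of \<open>q ^ label\<close> times the number of free edges to fresh vertices never
  decreases. Hence, once all vertices with label below \<open>t\<close> are exhausted, the tree has at
  least \<open>q ^ -t / 2\<close> vertices. The labels are the leaf depths of a binary tree recording the
  attachments, and a binary tree of height \<open>t\<close> with more than \<open>(t + 1) ^ D\<close> leaves has
  Horton--Strahler number above \<open>D\<close>, so for large \<open>t\<close> Maker's tree contains every forest on
  \<open>D\<close> vertices as a minor.\<close>

section \<open>Forests\<close>

text \<open>A step to a new vertex extends the path; a step to a vertex already on it cuts the path
  back there. The bound \<open>insert x (Range R)\<close> serves to keep an outside vertex off the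
  path.\<close>

lemma rtrancl_imp_distinct_path:
  assumes "(x, y) \<in> R\<^sup>*"
  shows "\<exists>p. p \<noteq> [] \<and> hd p = x \<and> last p = y \<and> distinct p \<and> successively (\<lambda>a b. (a, b) \<in> R) p
    \<and> set p \<subseteq> insert x (Range R)"
  using assms
proof (induction rule: rtrancl_induct)
  case base
  show ?case by (rule exI[of _ "[x]"]) auto
next
  case (step y z)
  then obtain p where p: "p \<noteq> []" "hd p = x" "last p = y" "distinct p"
    "successively (\<lambda>a b. (a, b) \<in> R) p" "set p \<subseteq> insert x (Range R)" by blast
  show ?case
  proof (cases "z \<in> set p")
    case True
    then obtain q q' where "p = q @ z # q'" by (meson split_list)
    with p show ?thesis
      by (intro exI[of _ "q @ [z]"]) (auto simp: successively_append_iff hd_append)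
  next
    case False
    with p step(2) show ?thesis
      by (intro exI[of _ "p @ [z]"]) (auto simp: successively_append_iff)
  qed
qed

lemma path_closes_to_cycle:
  assumes "p \<noteq> []" "distinct p" "r \<notin> set p" "hd p \<noteq> last p"
    and succ: "successively (\<lambda>a b. {a, b} \<in> E) p"
    and "{r, hd p} \<in> E" "{r, last p} \<in> E"
  shows "is_cycle E (r # p)"
  unfolding is_cycle_def
proof (intro conjI allI impI)
  have len: "length p \<ge> 2"
    using assms(1,4) by (cases p; cases "tl p") auto
  then show "length (r # p) \<ge> 3" by simp
  show "distinct (r # p)" using assms by simp
  fix i assume i: "i < length (r # p)"
  \<comment> \<open>Three kinds of edges: from \<open>r\<close> into the path, along the path, and,
    where the index wraps around, from the last vertex back to \<open>r\<close>.\<close>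
  consider "i = 0" | j where "i = Suc j" "Suc j < length p" | "i = length p"
    using i by (cases i) (auto simp: less_Suc_eq)
  then show "{(r # p) ! i, (r # p) ! ((i + 1) mod length (r # p))} \<in> E"
  proof cases
    case 1
    then show ?thesis using assms(1,6) len by (simp add: hd_conv_nth)
  next
    case 2
    then show ?thesis using succ by (simp add: successively_conv_nth)
  next
    case 3
    then show ?thesis using assms(1,7) by (simp add: last_conv_nth insert_commute nth_Cons')
  qed
qed

text \<open>Take for \<open>Y\<close> a connected component of \<open>X - {r}\<close>: only
  \<open>r\<close> can be adjacent to it from outside, and two edges from \<open>r\<close> into it
  would close a cycle.\<close>

lemma forest_split:
  assumes "forest V E" "X \<subseteq> V" "r \<in> X" "X \<noteq> {r}"
  shows "\<exists>Y y. Y \<subseteq> X - {r} \<and> y \<in> Y \<and> (\<forall>v\<in>X - Y. \<forall>w\<in>Y. {v, w} \<in> E \<longrightarrow> v = r \<and> w = y)"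
proof -
  define G where "G = {(u, v). u \<in> X - {r} \<and> v \<in> X - {r} \<and> {u, v} \<in> E}"
  have noloop: "{r, r} \<notin> E"
    using assms(1) by (auto simp: forest_def simple_graph_def nsets_def)
  \<comment> \<open>A neighbour of \<open>r\<close> in \<open>X\<close> if there is one; otherwise
    any other vertex, and then no edge joins \<open>Y\<close> to the rest of
    \<open>X\<close>.\<close>
  obtain y where y: "y \<in> X - {r}" and nb: "\<And>w. w \<in> X \<Longrightarrow> {r, w} \<in> E \<Longrightarrow> {r, y} \<in> E"
  proof (cases "\<exists>w\<in>X. {r, w} \<in> E")
    case True
    then show ?thesis using that noloop by blast
  next
    case False
    then show ?thesis using that assms(3,4) by blast
  qed
  define Y where "Y = {w. (y, w) \<in> G\<^sup>*}"
  have YX: "Y \<subseteq> X - {r}"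
  proof
    fix w assume "w \<in> Y"
    then have "(y, w) \<in> G\<^sup>*" by (simp add: Y_def)
    then show "w \<in> X - {r}" using y by (induction rule: rtrancl_induct) (auto simp: G_def)
  qed
  have "v = r \<and> w = y" if vw: "v \<in> X - Y" "w \<in> Y" "{v, w} \<in> E" for v w
  proof -
    have v: "v = r"
    proof (rule ccontr)
      assume "v \<noteq> r"
      then have "(w, v) \<in> G" using vw YX by (auto simp: G_def insert_commute)
      then have "v \<in> Y" using vw(2) by (auto simp: Y_def)
      then show False using vw(1) by simp
    qed
    have "w = y"
    proof (rule ccontr)
      assume "w \<noteq> y"
      obtain p where p: "p \<noteq> []" "hd p = y" "last p = w" "distinct p"
        "successively (\<lambda>a b. (a, b) \<in> G) p" "set p \<subseteq> insert y (Range G)"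
        using rtrancl_imp_distinct_path[of y w G] vw(2) by (auto simp: Y_def)
      have "is_cycle E (r # p)"
      proof (rule path_closes_to_cycle)
        show "r \<notin> set p" using p(6) y by (auto simp: G_def)
        show "successively (\<lambda>a b. {a, b} \<in> E) p"
          by (rule successively_mono[OF p(5)]) (auto simp: G_def)
        show "{r, hd p} \<in> E" using p vw v nb[of w] YX by auto
      qed (use p vw v \<open>w \<noteq> y\<close> in auto)
      then show False using assms(1) by (auto simp: forest_def)
    qed
    with v show ?thesis by simp
  qed
  then show ?thesis using YX by (intro exI[of _ Y] exI[of _ y]) (auto simp: Y_def)
qed


section \<open>Linking trees and rooted minors\<close>

text \<open>A leaf stands for a vertex of Maker's tree and \<open>Link l r\<close> for the edge between the two roots,
  after which the left root stays the root. Attaching a new vertex \<open>u\<close> to \<open>v\<close> thus pushes both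
  \<open>v\<close> and \<open>u\<close> one level below the old leaf \<open>v\<close>; the depth of a leaf bounds
  the degree of its vertex and its distance from the root.\<close>

datatype (verts: 'a) ltree = Leaf 'a | Link "'a ltree" "'a ltree"

fun base :: "'a ltree \<Rightarrow> 'a" where
  "base (Leaf v) = v"
| "base (Link l r) = base l"

fun height :: "'a ltree \<Rightarrow> nat" where
  "height (Leaf v) = 0"
| "height (Link l r) = Suc (max (height l) (height r))"

text \<open>The Horton--Strahler number; the binomial tree of this order is a rooted minor of the
  represented tree.\<close>

fun rank :: "'a ltree \<Rightarrow> nat" where
  "rank (Leaf v) = 0"
| "rank (Link l r) = (if rank l = rank r then Suc (rank l) else max (rank l) (rank r))"

text \<open>Disjoint halves make every vertex a leaf exactly once, so the linked bases form a
  genuine tree in the graph.\<close>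

fun ltree_in :: "'a set set \<Rightarrow> 'a ltree \<Rightarrow> bool" where
  "ltree_in E (Leaf v) = True"
| "ltree_in E (Link l r) \<longleftrightarrow> verts l \<inter> verts r = {} \<and> {base l, base r} \<in> E \<and> ltree_in E l \<and> ltree_in E r"

fun depth :: "'a ltree \<Rightarrow> 'a \<Rightarrow> nat" where
  "depth (Leaf x) v = 0"
| "depth (Link l r) v = Suc (if v \<in> verts l then depth l v else depth r v)"

fun attach :: "'a \<Rightarrow> 'a \<Rightarrow> 'a ltree \<Rightarrow> 'a ltree" where
  "attach v u (Leaf x) = (if x = v then Link (Leaf v) (Leaf u) else Leaf x)"
| "attach v u (Link l r) = Link (attach v u l) (attach v u r)"

section \<open>Size, height and attachment in linking trees\<close>

lemma base_in_verts: "base \<tau> \<in> verts \<tau>"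
  by (induction \<tau>) auto

lemma finite_verts: "finite (verts \<tau>)"
  by (induction \<tau>) auto

lemma card_verts_le_power_height: "card (verts \<tau>) \<le> 2 ^ height \<tau>"
proof (induction \<tau>)
  case (Link l r)
  have "card (verts (Link l r)) \<le> card (verts l) + card (verts r)" by (simp add: card_Un_le)
  also have "\<dots> \<le> 2 ^ max (height l) (height r) + 2 ^ max (height l) (height r)"
    by (intro add_mono order.trans[OF Link.IH(1)] order.trans[OF Link.IH(2)] power_increasing) auto
  finally show ?case by simp
qed simp

text \<open>Equal ranks add one, so at most one half of a link has rank \<open>D\<close> and the
  other has rank at most \<open>D - 1\<close>. This gives a Pascal-type recursion in
  \<open>t\<close> and \<open>D\<close>.\<close>

lemma card_verts_le_of_rank:
  "height \<tau> \<le> t \<Longrightarrow> rank \<tau> \<le> D \<Longrightarrow> card (verts \<tau>) \<le> (t + 1) ^ D"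
proof (induction \<tau> arbitrary: t D)
  case (Link l r)
  then obtain t' where t: "t = Suc t'" by (cases t) auto
  from Link.prems(2) obtain D' where D: "D = Suc D'" by (cases D) (auto split: if_splits)
  have h: "height l \<le> t'" "height r \<le> t'" using Link.prems t by auto
  have "rank l \<le> D \<and> rank r \<le> D' \<or> rank l \<le> D' \<and> rank r \<le> D"
    using Link.prems(2) D by (auto split: if_splits)
  then have "card (verts l) + card (verts r) \<le> (t' + 1) ^ D + (t' + 1) ^ D'"
  proof
    assume "rank l \<le> D \<and> rank r \<le> D'"
    then show ?thesis using Link.IH(1)[OF h(1)] Link.IH(2)[OF h(2)] by (meson add_mono)
  next
    assume "rank l \<le> D' \<and> rank r \<le> D"
    then show ?thesis using Link.IH(1)[OF h(1)] Link.IH(2)[OF h(2)] by (metis add.commute add_mono)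
  qed
  \<comment> \<open>Factoring out \<open>(t' + 1) ^ D'\<close> leaves \<open>t' + 2\<close>, which
    is the base \<open>t + 1\<close> of the bound.\<close>
  also have "\<dots> = (t' + 2) * (t' + 1) ^ D'" using D by (simp add: algebra_simps)
  also have "\<dots> \<le> (t' + 2) * (t' + 2) ^ D'" by (intro mult_left_mono power_mono) auto
  finally have "card (verts l) + card (verts r) \<le> (t + 1) ^ D" using t D by simp
  then show ?case using card_Un_le[of "verts l" "verts r"] by simp
qed simp

lemma ltree_in_mono: "ltree_in E \<tau> \<Longrightarrow> E \<subseteq> E' \<Longrightarrow> ltree_in E' \<tau>"
  by (induction \<tau>) auto

lemma verts_attach: "verts (attach v u \<tau>) = (if v \<in> verts \<tau> then insert u (verts \<tau>) else verts \<tau>)"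
  by (induction \<tau>) auto

lemma base_attach [simp]: "base (attach v u \<tau>) = base \<tau>"
  by (induction \<tau>) auto

lemma ltree_in_attach:
  "ltree_in E \<tau> \<Longrightarrow> u \<notin> verts \<tau> \<Longrightarrow> {v, u} \<in> E \<Longrightarrow> ltree_in E (attach v u \<tau>)"
  by (induction \<tau>) (auto simp: verts_attach)

lemma attach_fresh: "v \<notin> verts \<tau> \<Longrightarrow> attach v u \<tau> = \<tau>"
  by (induction \<tau>) auto

lemma depth_attach:
  assumes "ltree_in E \<tau>" "u \<notin> verts \<tau>" "v \<in> verts \<tau>" "x \<in> insert u (verts \<tau>)"
  shows "depth (attach v u \<tau>) x = (if x = u \<or> x = v then Suc (depth \<tau> v) else depth \<tau> x)"
  using assms
  by (induction \<tau>) (auto simp: verts_attach attach_fresh disjoint_iff split: if_splits)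

lemma height_attach:
  assumes "ltree_in E \<tau>" "v \<in> verts \<tau>" "depth \<tau> v < t" "height \<tau> \<le> t"
  shows "height (attach v u \<tau>) \<le> t"
  using assms
proof (induction \<tau> arbitrary: t)
  case (Link l r)
  then obtain t' where "t = Suc t'" by (cases t) auto
  then show ?case
    using Link by (cases "v \<in> verts l") (auto simp: attach_fresh disjoint_iff)
qed auto

section \<open>Building minor models\<close>

lemma induces_connected_insert:
  assumes "induces_connected E A" "y \<in> A" "{x, y} \<in> E"
  shows "induces_connected E (insert x A)"
proof -
  let ?R = "\<lambda>S. {(u, v). u \<in> S \<and> v \<in> S \<and> {u, v} \<in> E}"
  have sub: "(?R A)\<^sup>* \<subseteq> (?R (insert x A))\<^sup>*" by (intro rtrancl_mono) auto
  have xy: "(x, y) \<in> (?R (insert x A))\<^sup>*" "(y, x) \<in> (?R (insert x A))\<^sup>*"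
    using assms(2,3) by (auto simp: insert_commute intro!: r_into_rtrancl)
  have "(u, y) \<in> (?R (insert x A))\<^sup>* \<and> (y, u) \<in> (?R (insert x A))\<^sup>*" if "u \<in> insert x A" for u
    using that xy sub assms(1,2) unfolding induces_connected_def by blast
  then show ?thesis unfolding induces_connected_def by (meson rtrancl_trans)
qed

lemma is_minor_mono:
  assumes "is_minor VH EH VM EM" "EM \<subseteq> EM'" "VM \<subseteq> VM'"
  shows "is_minor VH EH VM' EM'"
proof -
  obtain S where S: "\<forall>v\<in>VH. S v \<noteq> {} \<and> S v \<subseteq> VM \<and> induces_connected EM (S v)"
    "disjoint_family_on S VH" "\<forall>v\<in>VH. \<forall>w\<in>VH. {v, w} \<in> EH \<longrightarrow> (\<exists>x\<in>S v. \<exists>y\<in>S w. {x, y} \<in> EM)"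
    using assms(1) unfolding is_minor_def by blast
  have "induces_connected EM' A" if "induces_connected EM A" for A
  proof -
    have "{(u, v). u \<in> A \<and> v \<in> A \<and> {u, v} \<in> EM}\<^sup>* \<subseteq> {(u, v). u \<in> A \<and> v \<in> A \<and> {u, v} \<in> EM'}\<^sup>*"
      using assms(2) by (intro rtrancl_mono) auto
    with that show ?thesis unfolding induces_connected_def by blast
  qed
  then have "\<forall>v\<in>VH. S v \<noteq> {} \<and> S v \<subseteq> VM' \<and> induces_connected EM' (S v)"
    using S(1) assms(3) by blast
  moreover have "\<forall>v\<in>VH. \<forall>w\<in>VH. {v, w} \<in> EH \<longrightarrow> (\<exists>x\<in>S v. \<exists>y\<in>S w. {x, y} \<in> EM')"
    using S(3) assms(2) by (meson subsetD)
  ultimately show ?thesis unfolding is_minor_def using S(2) by blast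
qed

text \<open>Unlike in \<open>is_minor\<close>, the branch sets are explicit, so that one of them can
  be required to contain a given root; \<open>X\<close> and \<open>L\<close> are the parts of the
  pattern and of the host in use.\<close>

definition minor_model :: "'a set set \<Rightarrow> 'b set set \<Rightarrow> 'a set \<Rightarrow> 'b set \<Rightarrow> ('a \<Rightarrow> 'b set) \<Rightarrow> bool" where
  "minor_model EH EM X L S \<longleftrightarrow>
     (\<forall>v\<in>X. S v \<noteq> {} \<and> S v \<subseteq> L \<and> induces_connected EM (S v)) \<and> disjoint_family_on S X \<and>
     (\<forall>v\<in>X. \<forall>w\<in>X. {v, w} \<in> EH \<longrightarrow> (\<exists>x\<in>S v. \<exists>y\<in>S w. {x, y} \<in> EM))"

lemma minor_model_join:
  assumes "minor_model EH EM X1 L1 S1" "minor_model EH EM X2 L2 S2" "X1 \<inter> X2 = {}" "L1 \<inter> L2 = {}"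
    and cross: "\<And>v w. v \<in> X1 \<Longrightarrow> w \<in> X2 \<Longrightarrow> {v, w} \<in> EH \<Longrightarrow> \<exists>x\<in>S1 v. \<exists>y\<in>S2 w. {x, y} \<in> EM"
  shows "minor_model EH EM (X1 \<union> X2) (L1 \<union> L2) (\<lambda>x. if x \<in> X1 then S1 x else S2 x)"
proof -
  let ?S = "\<lambda>x. if x \<in> X1 then S1 x else S2 x"
  note S1 = assms(1)[unfolded minor_model_def] and S2 = assms(2)[unfolded minor_model_def]
  have X2: "v \<notin> X1" if "v \<in> X2" for v using assms(3) that by blast
  have bag: "?S v \<noteq> {} \<and> ?S v \<subseteq> L1 \<union> L2 \<and> induces_connected EM (?S v)" if "v \<in> X1 \<union> X2" for v
    using that S1 S2 by (cases "v \<in> X1") (simp_all add: le_supI1 le_supI2)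
  have disj: "disjoint_family_on ?S (X1 \<union> X2)"
    unfolding disjoint_family_on_def
  proof (intro ballI impI)
    fix v w assume vw: "v \<in> X1 \<union> X2" "w \<in> X1 \<union> X2" "v \<noteq> w"
    show "?S v \<inter> ?S w = {}"
    proof (cases "v \<in> X1"; cases "w \<in> X1")
      assume "v \<in> X1" "w \<in> X1"
      with vw S1 show ?thesis by (simp add: disjoint_family_on_def)
    next
      assume *: "v \<in> X1" "w \<notin> X1"
      then have "S1 v \<subseteq> L1" "S2 w \<subseteq> L2" using vw S1 S2 by auto
      with * assms(4) show ?thesis by auto
    next
      assume *: "v \<notin> X1" "w \<in> X1"
      then have "S2 v \<subseteq> L2" "S1 w \<subseteq> L1" using vw S1 S2 by auto
      with * assms(4) show ?thesis by auto
    next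
      assume "v \<notin> X1" "w \<notin> X1"
      with vw S2 show ?thesis by (simp add: disjoint_family_on_def)
    qed
  qed
  have edge: "\<exists>x\<in>?S v. \<exists>y\<in>?S w. {x, y} \<in> EM"
    if vw: "v \<in> X1 \<union> X2" "w \<in> X1 \<union> X2" "{v, w} \<in> EH" for v w
  proof (cases "v \<in> X1"; cases "w \<in> X1")
    assume "v \<in> X1" "w \<in> X1"
    with vw S1 show ?thesis by simp
  next
    assume "v \<in> X1" "w \<notin> X1"
    with vw cross show ?thesis by simp
  next
    assume *: "v \<notin> X1" "w \<in> X1"
    then have "\<exists>x\<in>S1 w. \<exists>y\<in>S2 v. {x, y} \<in> EM"
      using vw cross[of w v] by (simp add: insert_commute)
    then obtain x y where "x \<in> S1 w" "y \<in> S2 v" "{y, x} \<in> EM" by (auto simp: insert_commute)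
    with * show ?thesis by auto
  next
    assume "v \<notin> X1" "w \<notin> X1"
    with vw S2 show ?thesis by simp
  qed
  show ?thesis unfolding minor_model_def
    by (intro conjI ballI impI disj edge bag[THEN conjunct1] bag[THEN conjunct2, THEN conjunct1]
        bag[THEN conjunct2, THEN conjunct2])
qed

text \<open>Moves the root: a forest placed in the right half of a link is re-rooted at the left
  base by absorbing that base into the branch set of \<open>r\<close>.\<close>

lemma minor_model_extend_bag:
  assumes "minor_model EH EM X L S" "r \<in> X" "y \<in> S r" "{x, y} \<in> EM" "x \<notin> L"
  shows "minor_model EH EM X (insert x L) (S(r := insert x (S r)))"
proof -
  let ?T = "S(r := insert x (S r))"
  note S = assms(1)[unfolded minor_model_def]
  have "induces_connected EM (insert x (S r))"
    using assms by (intro induces_connected_insert[of _ _ y]) (auto simp: minor_model_def)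
  then have bag: "?T v \<noteq> {} \<and> ?T v \<subseteq> insert x L \<and> induces_connected EM (?T v)" if "v \<in> X" for v
    using that S assms(2) by auto
  have "x \<notin> S v" if "v \<in> X" for v using that S assms(5) by blast
  then have disj: "disjoint_family_on ?T X"
    using S unfolding disjoint_family_on_def by auto
  have sub: "S v \<subseteq> ?T v" for v by auto
  have "\<exists>x\<in>?T v. \<exists>y\<in>?T w. {x, y} \<in> EM" if "v \<in> X" "w \<in> X" "{v, w} \<in> EH" for v w
    using S that sub[of v] sub[of w] by (meson subsetD)
  then show ?thesis unfolding minor_model_def using bag disj by blast
qed

lemma minor_model_mono: "minor_model EH EM X L S \<Longrightarrow> L \<subseteq> L' \<Longrightarrow> minor_model EH EM X L' S"
  unfolding minor_model_def by blast

text \<open>When both halves of a link have rank one less than needed, the forest is split at its root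
  along at most one edge and the two parts are placed in the two halves.\<close>

lemma forest_rooted_minor:
  assumes "forest V E"
  shows "\<lbrakk>X \<subseteq> V; r \<in> X; ltree_in M \<tau>; card X \<le> Suc (rank \<tau>)\<rbrakk>
    \<Longrightarrow> \<exists>S. minor_model E M X (verts \<tau>) S \<and> base \<tau> \<in> S r"
proof (induction \<tau> arbitrary: X r)
  case (Leaf v)
  have fin: "finite X"
    using assms Leaf.prems(1) by (meson forest_def simple_graph_def finite_subset)
  then have "\<forall>x\<in>X. \<forall>y\<in>X. x = y" using Leaf.prems(4) card_le_Suc0_iff_eq[OF fin] by simp
  then have X: "X = {r}" using Leaf.prems(2) by blast
  have "{r, r} \<notin> E" using assms by (auto simp: forest_def simple_graph_def nsets_def)
  then show ?case
    by (intro exI[of _ "\<lambda>_. {v}"])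
      (auto simp: X minor_model_def disjoint_family_on_def induces_connected_def)
next
  case (Link a b)
  have fin: "finite X"
    using assms Link.prems(1) by (meson forest_def simple_graph_def finite_subset)
  have ab: "verts a \<inter> verts b = {}" "{base a, base b} \<in> M" "ltree_in M a" "ltree_in M b"
    using Link.prems by auto
  \<comment> \<open>If the ranks differ, \<open>X\<close> fits into the half of larger rank. If they
    agree, it fits into either half or is exactly one vertex too large.\<close>
  consider "card X \<le> Suc (rank a)" | "card X \<le> Suc (rank b)"
    | "card X = Suc (Suc (rank a))" "rank a = rank b"
    using Link.prems(4) by (cases "rank a" "rank b" rule: linorder_cases) (auto simp: le_Suc_eq)
  then show ?case
  proof cases
    case 1
    from Link.IH(1)[OF Link.prems(1,2) ab(3) 1]
    obtain S where "minor_model E M X (verts a) S" "base a \<in> S r" by blast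
    then show ?thesis using minor_model_mono[of E M X "verts a" S] by (intro exI[of _ S]) simp
  next
    case 2
    from Link.IH(2)[OF Link.prems(1,2) ab(4) 2]
    obtain S where S: "minor_model E M X (verts b) S" "base b \<in> S r" by blast
    have "minor_model E M X (insert (base a) (verts b)) (S(r := insert (base a) (S r)))"
      using ab(1) base_in_verts[of a] by (intro minor_model_extend_bag[OF S(1) Link.prems(2) S(2) ab(2)]) auto
    then have "minor_model E M X (verts (Link a b)) (S(r := insert (base a) (S r)))"
      by (rule minor_model_mono) (use base_in_verts[of a] in auto)
    then show ?thesis by (rule exI[of _ "S(r := insert (base a) (S r))", OF conjI]) simp
  next
    case 3
    have "X \<noteq> {r}" using 3 by auto
    then obtain Y y where Y: "Y \<subseteq> X - {r}" "y \<in> Y"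
      "\<And>v w. v \<in> X - Y \<Longrightarrow> w \<in> Y \<Longrightarrow> {v, w} \<in> E \<Longrightarrow> v = r \<and> w = y"
      using forest_split[OF assms Link.prems(1,2)] by blast
    \<comment> \<open>\<open>r\<close> is missing from \<open>Y\<close> and \<open>y\<close> from
      \<open>X - Y\<close>, so both parts are smaller than \<open>X\<close> and fit.\<close>
    have "card (X - Y) < card X" "card Y < card X"
      using Y Link.prems fin by (auto intro!: psubset_card_mono)
    then have le: "card (X - Y) \<le> Suc (rank a)" "card Y \<le> Suc (rank b)" using 3 by auto
    obtain S1 where S1: "minor_model E M (X - Y) (verts a) S1" "base a \<in> S1 r"
      using Link.IH(1)[OF _ _ ab(3) le(1)] Link.prems(1,2) Y(1) by blast
    obtain S2 where S2: "minor_model E M Y (verts b) S2" "base b \<in> S2 y"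
      using Link.IH(2)[OF _ Y(2) ab(4) le(2)] Link.prems(1) Y(1) by blast
    define S where "S x = (if x \<in> X - Y then S1 x else S2 x)" for x
    have "minor_model E M ((X - Y) \<union> Y) (verts a \<union> verts b) S"
      unfolding S_def
    proof (rule minor_model_join[OF S1(1) S2(1)])
      \<comment> \<open>The only possible forest edge between the parts is \<open>{r, y}\<close>;
        the link between the two bases realises it.\<close>
      fix v w assume "v \<in> X - Y" "w \<in> Y" "{v, w} \<in> E"
      then show "\<exists>x\<in>S1 v. \<exists>y\<in>S2 w. {x, y} \<in> M" using Y(3) S1(2) S2(2) ab(2) by blast
    qed (use ab(1) in auto)
    moreover have "(X - Y) \<union> Y = X" using Y(1) by blast
    moreover have "base a \<in> S r"
      using Y(1) Link.prems(2) S1(2) by (auto simp: S_def)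
    ultimately show ?thesis by (intro exI[of _ S]) simp
  qed
qed

lemma forest_minor_of_ltree:
  assumes "forest V E" "ltree_in M \<tau>" "card V \<le> Suc (rank \<tau>)" "verts \<tau> \<subseteq> U"
  shows "is_minor V E U M"
proof (cases "V = {}")
  case True
  then show ?thesis by (simp add: is_minor_def disjoint_family_on_def)
next
  case False
  then obtain r where "r \<in> V" by blast
  then have "is_minor V E (verts \<tau>) M"
    using forest_rooted_minor[OF assms(1) order.refl _ assms(2,3)]
    unfolding is_minor_def minor_model_def by metis
  then show ?thesis using is_minor_mono assms(4) by blast
qed


section \<open>Winning by an invariant\<close>

text \<open>Choosing at each history a move that preserves \<open>I\<close> against every reply
  defines the strategy. Replies of at most \<open>b\<close> elements include the shorter last
  one.\<close>

lemma maker_wins_by_invariant: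
  assumes start: "I []"
    and step: "\<And>h. I h \<Longrightarrow> unclaimed X h \<noteq> {} \<Longrightarrow>
      \<exists>e\<in>unclaimed X h. \<forall>F. F \<subseteq> unclaimed X h - {e} \<and> card F \<le> b \<longrightarrow> I (h @ [(e, F)])"
    and final: "\<And>h. I h \<Longrightarrow> unclaimed X h = {} \<Longrightarrow> W (maker_claimed h)"
  shows "\<exists>\<sigma>. maker_winning_strategy X b W \<sigma>"
proof -
  define good where "good h e \<longleftrightarrow> e \<in> unclaimed X h \<and>
    (\<forall>F. F \<subseteq> unclaimed X h - {e} \<and> card F \<le> b \<longrightarrow> I (h @ [(e, F)]))" for h e
  define \<sigma> where "\<sigma> h = (SOME e. good h e)" for h
  have good: "good h (\<sigma> h)" if "I h" "unclaimed X h \<noteq> {}" for h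
    using step[OF that] unfolding \<sigma>_def by (intro someI_ex[of "good h"]) (auto simp: good_def)
  have "I h" if "reachable X b \<sigma> h" for h
    using that
  proof induction
    case (round h F)
    then have "good h (\<sigma> h)" using good by blast
    then show ?case using round by (simp add: good_def)
  qed (rule start)
  then show ?thesis
    unfolding maker_winning_strategy_def using good final by (intro exI[of _ \<sigma>]) (auto simp: good_def)
qed


lemma maker_claimed_snoc [simp]: "maker_claimed (h @ [(e, F)]) = insert e (maker_claimed h)"
  by (auto simp: maker_claimed_def)

lemma breaker_claimed_snoc [simp]: "breaker_claimed (h @ [(e, F)]) = breaker_claimed h \<union> F"
  by (auto simp: breaker_claimed_def)


section \<open>The potential\<close>

text \<open>With all of Maker's edges inside \<open>L\<close>, an edge from \<open>v\<close> in
  \<open>L\<close> to a vertex outside is free as soon as it avoids Breaker's set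
  \<open>B\<close>.\<close>

definition escapes :: "nat \<Rightarrow> nat set set \<Rightarrow> nat set \<Rightarrow> nat \<Rightarrow> nat set" where
  "escapes n B L v = {y \<in> {..<n} - L. {v, y} \<notin> B}"

text \<open>Only the excess over \<open>c * n\<close> counts, so that from every vertex of positive weight Maker can
  reach a vertex of small Breaker degree.\<close>

definition weight :: "real \<Rightarrow> nat \<Rightarrow> nat set set \<Rightarrow> nat set \<Rightarrow> nat \<Rightarrow> real" where
  "weight c n B L v = max 0 (real (card (escapes n B L v)) - c * real n)"

definition potential :: "real \<Rightarrow> real \<Rightarrow> nat \<Rightarrow> nat set set \<Rightarrow> nat ltree \<Rightarrow> real" where
  "potential c q n B \<tau> = (\<Sum>v\<in>verts \<tau>. q ^ depth \<tau> v * weight c n B (verts \<tau>) v)"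

definition crossing :: "nat \<Rightarrow> nat set set \<Rightarrow> nat set \<Rightarrow> nat \<Rightarrow> nat set" where
  "crossing n F L x = {y \<in> {..<n} - L. {x, y} \<in> F}"

section \<open>The effect of one round on the potential\<close>

lemma weight_nonneg [simp]: "0 \<le> weight c n B L v"
  by (simp add: weight_def)

lemma weight_le:
  assumes "0 \<le> c" shows "weight c n B L v \<le> real n"
proof -
  have "card (escapes n B L v) \<le> card {..<n}" by (intro card_mono) (auto simp: escapes_def)
  then show ?thesis using assms by (auto simp: weight_def intro: order.trans[of _ "real (card (escapes n B L v))"])
qed

text \<open>An edge leaving \<open>L\<close> has only one end in \<open>L\<close>, so it is counted
  once.\<close>

lemma sum_card_crossing_le:
  assumes "finite F" "finite L"
  shows "(\<Sum>x\<in>L. card (crossing n F L x)) \<le> card F"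
proof -
  let ?A = "\<lambda>x. (\<lambda>y. {x, y}) ` crossing n F L x"
  have "card (crossing n F L x) = card (?A x)" for x
    by (rule card_image[symmetric]) (auto simp: inj_on_def doubleton_eq_iff)
  then have "(\<Sum>x\<in>L. card (crossing n F L x)) = (\<Sum>x\<in>L. card (?A x))" by simp
  also have "\<dots> = card (\<Union>x\<in>L. ?A x)"
    by (rule card_UN_disjoint[symmetric])
      (use assms in \<open>auto simp: crossing_def doubleton_eq_iff\<close>)
  also have "\<dots> \<le> card F"
    by (rule card_mono) (use assms in \<open>auto simp: crossing_def\<close>)
  finally show ?thesis .
qed

text \<open>The escapes lost are \<open>u\<close>, now in the tree, and those cut by
  \<open>F\<close>; truncation at 0 does not magnify the loss.\<close>

lemma weight_after_round:
  "weight c n B L x - 1 - card (crossing n F (insert u L) x) \<le> weight c n (B \<union> F) (insert u L) x"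
proof -
  have "escapes n B L x \<subseteq> insert u (crossing n F (insert u L) x \<union> escapes n (B \<union> F) (insert u L) x)"
    by (auto simp: escapes_def crossing_def)
  moreover have fin: "finite (crossing n F (insert u L) x)" "finite (escapes n (B \<union> F) (insert u L) x)"
    by (auto simp: crossing_def escapes_def)
  ultimately have "card (escapes n B L x)
      \<le> card (insert u (crossing n F (insert u L) x \<union> escapes n (B \<union> F) (insert u L) x))"
    by (intro card_mono) auto
  also have "\<dots> \<le> Suc (card (crossing n F (insert u L) x) + card (escapes n (B \<union> F) (insert u L) x))"
    by (rule order.trans[OF card_insert_le_m1]) (use fin in \<open>auto simp: card_Un_le\<close>)
  finally show ?thesis by (auto simp: weight_def)
qed

lemma weight_new_vertex:
  assumes "finite L"
  shows "n - real (card L) - card {y \<in> {..<n}. {u, y} \<in> B} - card (crossing n F L u) - c * n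
    \<le> weight c n (B \<union> F) L u"
proof -
  have "{..<n} \<subseteq> L \<union> {y \<in> {..<n}. {u, y} \<in> B} \<union> crossing n F L u \<union> escapes n (B \<union> F) L u"
    by (auto simp: escapes_def crossing_def)
  then have "card {..<n}
      \<le> card (L \<union> {y \<in> {..<n}. {u, y} \<in> B} \<union> crossing n F L u \<union> escapes n (B \<union> F) L u)"
    by (intro card_mono) (use assms in \<open>auto simp: crossing_def escapes_def\<close>)
  also have "\<dots> \<le> card L + card {y \<in> {..<n}. {u, y} \<in> B} + card (crossing n F L u)
      + card (escapes n (B \<union> F) L u)"
    by (intro order.trans[OF card_Un_le] add_mono order.refl)
  finally show ?thesis by (auto simp: weight_def)
qed

text \<open>In units of \<open>q ^ depth \<tau> v\<close>, with \<open>q = 1 - \<epsilon>/4\<close>: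
  the new vertex brings about \<open>q * n\<close>, and pushing \<open>v\<close> down costs at most
  \<open>(1 - q) * n\<close>. As all vertices of positive weight are at least as deep as
  \<open>v\<close>, each edge of Breaker, and each loss of \<open>u\<close> as an escape, costs at
  most one unit.\<close>

lemma potential_after_round:
  fixes \<epsilon> :: real
  assumes eps: "0 < \<epsilon>" "\<epsilon> \<le> 1"
    and \<tau>: "ltree_in M \<tau>" "v \<in> verts \<tau>" "u \<notin> verts \<tau>"
    and shallow: "\<And>x. x \<in> verts \<tau> \<Longrightarrow> 0 < weight (\<epsilon>/8) n B (verts \<tau>) x \<Longrightarrow> depth \<tau> v \<le> depth \<tau> x"
    and deg: "card {y \<in> {..<n}. {u, y} \<in> B} \<le> \<epsilon>/8 * n"
    and small: "card (verts \<tau>) + 1 \<le> \<epsilon>/8 * n"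
    and F: "finite F" "card F \<le> (1 - \<epsilon>) * n"
  shows "potential (\<epsilon>/8) (1 - \<epsilon>/4) n B \<tau> \<le> potential (\<epsilon>/8) (1 - \<epsilon>/4) n (B \<union> F) (attach v u \<tau>)"
proof -
  define q c where "q = 1 - \<epsilon>/4" and "c = \<epsilon>/8"
  define L l where "L = verts \<tau>" and "l = depth \<tau> v"
  define f where "f x = real (card (crossing n F (insert u L) x))" for x
  define W where "W x = weight c n B L x" for x
  define W' where "W' x = weight c n (B \<union> F) (insert u L) x" for x
  define d where "d x = q ^ depth \<tau> x" for x
  have q: "0 < q" "q \<le> 1" using eps by (auto simp: q_def)
  have fin: "finite L" by (simp add: L_def finite_verts)
  have uv: "u \<notin> L" "v \<in> L" using \<tau> by (auto simp: L_def)
  have nonneg: "0 \<le> W x" "0 \<le> W' x" "0 \<le> f x" for x by (auto simp: W_def W'_def f_def)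
  have round: "W x - (1 + f x) \<le> W' x" for x
    using weight_after_round[of c n B L x F u] by (simp add: W_def W'_def f_def)
  have dl: "0 < d v" using q by (simp add: d_def)
  have sumf: "f u + (\<Sum>x\<in>L. f x) \<le> (1 - \<epsilon>) * n"
  proof -
    have "(\<Sum>x\<in>insert u L. card (crossing n F (insert u L) x)) \<le> card F"
      by (rule sum_card_crossing_le) (use F fin in auto)
    then have "real (\<Sum>x\<in>insert u L. card (crossing n F (insert u L) x)) \<le> card F" by linarith
    then have "(\<Sum>x\<in>insert u L. f x) \<le> card F" by (simp add: f_def)
    then show ?thesis using F(2) fin uv by simp
  qed
  \<comment> \<open>Vertices of weight zero may be shallower than \<open>v\<close>, but they have
    nothing to lose.\<close>
  have other: "d x * W x - d v * (1 + f x) \<le> d x * W' x" if "x \<in> L" for x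
  proof (cases "0 < W x")
    case True
    then have "d x \<le> d v"
      using shallow[of x] that q by (auto simp: d_def L_def W_def c_def intro!: power_decreasing)
    then have "d x * (1 + f x) \<le> d v * (1 + f x)" using nonneg by (intro mult_right_mono) auto
    moreover have "d x * (W x - (1 + f x)) \<le> d x * W' x"
      using round[of x] q by (intro mult_left_mono) (auto simp: d_def)
    ultimately show ?thesis by (simp add: algebra_simps)
  next
    case False
    then have "W x = 0" using nonneg[of x] by simp
    moreover have "0 \<le> d v * (1 + f x)" "0 \<le> d x * W' x"
      using dl nonneg q by (auto simp: d_def)
    ultimately show ?thesis by simp
  qed
  have at_v: "d v * (W v - (1 - q) * n - (1 + f v)) \<le> d v * (q * W' v)"
  proof (rule mult_left_mono)
    have "(1 - q) * W v \<le> (1 - q) * n"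
      using weight_le[of c n B L v] eps q by (intro mult_left_mono) (auto simp: W_def c_def)
    moreover have "q * (1 + f v) \<le> 1 * (1 + f v)" using q nonneg by (intro mult_right_mono) auto
    moreover have "q * (W v - (1 + f v)) \<le> q * W' v" using round[of v] q by (intro mult_left_mono) auto
    ultimately show "W v - (1 - q) * n - (1 + f v) \<le> q * W' v" by (simp add: algebra_simps)
  qed (use dl in simp)
  \<comment> \<open>One \<open>c * n\<close> is the Breaker degree of \<open>u\<close>, the other
    the threshold in \<open>weight\<close>.\<close>
  have at_u: "d v * (q * n - (card L + 1) - 2 * c * n - f u) \<le> d v * (q * W' u)"
  proof (rule mult_left_mono)
    define R where "R = real (card L + 1) + 2 * c * n + f u"
    have "n - R \<le> W' u"
      using weight_new_vertex[of "insert u L" n u B F c] fin uv deg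
      by (simp add: W'_def f_def R_def c_def)
    then have "q * (n - R) \<le> q * W' u" using q by (intro mult_left_mono) auto
    moreover have "q * R \<le> 1 * R" using q nonneg[of u] eps by (intro mult_right_mono) (auto simp: R_def c_def)
    ultimately show "q * n - (card L + 1) - 2 * c * n - f u \<le> q * W' u"
      by (simp add: R_def algebra_simps)
  qed (use dl in simp)
  have "0 < card L" using uv fin by (auto simp: card_gt_0_iff)
  then have cardL: "real (card L - 1) = real (card L) - 1" by simp
  have rest: "(\<Sum>x\<in>L - {v}. d x * W x) - d v * (real (card L) - 1 + (\<Sum>x\<in>L - {v}. f x)) \<le> (\<Sum>x\<in>L - {v}. d x * W' x)"
  proof -
    have "(\<Sum>x\<in>L - {v}. d x * W x - d v * (1 + f x)) \<le> (\<Sum>x\<in>L - {v}. d x * W' x)"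
      by (rule sum_mono) (use other in auto)
    moreover have "(\<Sum>x\<in>L - {v}. 1 + f x) = real (card L) - 1 + (\<Sum>x\<in>L - {v}. f x)"
      using uv fin cardL by (simp add: sum.distrib)
    ultimately show ?thesis by (simp add: sum_subtractf flip: sum_distrib_left)
  qed
  have old: "potential c q n B \<tau> = d v * W v + (\<Sum>x\<in>L - {v}. d x * W x)"
    using uv fin by (simp add: potential_def L_def[symmetric] d_def W_def sum.remove[of L v])
  have new: "potential c q n (B \<union> F) (attach v u \<tau>)
      = d v * (q * W' u) + d v * (q * W' v) + (\<Sum>x\<in>L - {v}. d x * W' x)"
  proof -
    have "verts (attach v u \<tau>) = insert u L" using \<tau> by (simp add: verts_attach L_def)
    then have "potential c q n (B \<union> F) (attach v u \<tau>)
        = (\<Sum>x\<in>insert u L. q ^ depth (attach v u \<tau>) x * W' x)"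
      by (simp add: potential_def W'_def)
    also have "\<dots> = (\<Sum>x\<in>insert u L. (if x = u \<or> x = v then q * d v else d x) * W' x)"
      by (rule sum.cong) (use depth_attach[OF \<tau>(1,3,2)] in \<open>auto simp: d_def L_def\<close>)
    also have "\<dots> = q * d v * W' u + (q * d v * W' v + (\<Sum>x\<in>L - {v}. (if x = u \<or> x = v then q * d v else d x) * W' x))"
      using uv fin by (simp add: sum.remove[of L v])
    also have "(\<Sum>x\<in>L - {v}. (if x = u \<or> x = v then q * d v else d x) * W' x) = (\<Sum>x\<in>L - {v}. d x * W' x)"
      by (rule sum.cong) (use uv in auto)
    finally show ?thesis by (simp add: mult_ac)
  qed
  define S where "S = (\<Sum>x\<in>L - {v}. f x)"
  have "(\<Sum>x\<in>L. f x) = f v + S" using uv fin by (simp add: S_def sum.remove)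
  \<comment> \<open>Here the constants balance: the surplus \<open>2 * (\<epsilon>/8 * n)\<close>
    over Breaker's bias pays for \<open>2 * card L + 1\<close>.\<close>
  moreover have "(2 * q - 1 - 2 * c) * n = (1 - \<epsilon>) * n + 2 * (\<epsilon>/8 * n)"
    by (simp add: q_def c_def algebra_simps)
  moreover have "real (card L) + 1 \<le> \<epsilon>/8 * n" using small by (simp add: L_def)
  ultimately have "0 \<le> (2 * q - 1 - 2 * c) * n - 2 * real (card L) - 1 - (f u + (f v + S))"
    using sumf by linarith
  then have "0 \<le> d v * ((2 * q - 1 - 2 * c) * n - 2 * real (card L) - 1 - (f u + (f v + S)))"
    using dl by simp
  also have "\<dots> = d v * (W v - (1 - q) * n - (1 + f v))
      + d v * (q * n - real (card L + 1) - 2 * c * n - f u) - d v * (real (card L) - 1 + S) - d v * W v"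
    by (simp add: algebra_simps)
  finally have "potential c q n B \<tau> \<le> potential c q n (B \<union> F) (attach v u \<tau>)"
    unfolding old new using at_u at_v rest[folded S_def] by linarith
  then show ?thesis by (simp add: q_def c_def)
qed

text \<open>Double counting: if all of \<open>C\<close> had Breaker degree above
  \<open>c * n\<close>, there would be more than \<open>c * c * n * n / 2\<close> edges in
  \<open>B\<close>, since each contains at most two vertices of \<open>C\<close>.\<close>

lemma low_degree_vertex:
  fixes c s :: real and n :: nat
  assumes "B \<subseteq> nsets {..<n} 2" "card B \<le> s * n" "finite C" "c * n < card C"
    and "0 < c" "0 < n" "2 * s \<le> c * c * n"
  shows "\<exists>u\<in>C. card {y \<in> {..<n}. {u, y} \<in> B} \<le> c * n"
proof (rule ccontr)
  assume "\<not> ?thesis"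
  then have high: "c * n < card {y \<in> {..<n}. {u, y} \<in> B}" if "u \<in> C" for u
    using that by (meson not_le)
  have finB: "finite B" using assms(1) by (rule finite_subset) (simp add: finite_imp_finite_nsets)
  have le: "card {y \<in> {..<n}. {u, y} \<in> B} \<le> card {e \<in> B. u \<in> e}" for u
    by (rule card_inj_on_le[of "\<lambda>y. {u, y}"]) (use finB in \<open>auto simp: inj_on_def doubleton_eq_iff\<close>)
  have "c * n \<le> card {e \<in> B. u \<in> e}" if "u \<in> C" for u
    using high[OF that] le[of u] by linarith
  then have "(\<Sum>u\<in>C. c * n) \<le> (\<Sum>u\<in>C. real (card {e \<in> B. u \<in> e}))" by (intro sum_mono) auto
  also have "(\<Sum>u\<in>C. real (card {e \<in> B. u \<in> e})) = (\<Sum>e\<in>B. real (card {u \<in> C. u \<in> e}))"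
  proof -
    have "(\<Sum>u\<in>C. card {e \<in> B. u \<in> e}) = (\<Sum>e\<in>B. card {u \<in> C. u \<in> e})"
      using finB assms(3) by (intro sum_multicount_gen) simp_all
    then show ?thesis by (simp only: of_nat_sum[symmetric])
  qed
  also have "\<dots> \<le> (\<Sum>e\<in>B. 2)"
  proof (rule sum_mono)
    fix e assume "e \<in> B"
    then have e: "finite e" "card e = 2" using assms(1) by (auto simp: nsets_def)
    have "card {u \<in> C. u \<in> e} \<le> card e" by (rule card_mono) (use e in auto)
    then show "real (card {u \<in> C. u \<in> e}) \<le> 2" using e by simp
  qed
  finally have "card C * (c * n) \<le> 2 * card B" by simp
  with assms(2) have "card C * (c * n) \<le> 2 * (s * n)" by linarith
  moreover have "c * n * (c * n) < card C * (c * n)"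
    using assms(4,5,6) by (intro mult_strict_right_mono) auto
  moreover have "2 * (s * n) \<le> c * n * (c * n)"
    using assms(7) mult_right_mono[of "2 * s" "c * c * n" "real n"] by (simp add: mult_ac)
  ultimately show False by linarith
qed

text \<open>Only vertices at depth at least \<open>t\<close> contribute, each at most
  \<open>q ^ t * n\<close>. Rank at most \<open>D\<close> would leave too few vertices to reach
  \<open>n / 2\<close>.\<close>

lemma rank_of_saturated:
  fixes c q :: real
  assumes pot: "n / 2 \<le> potential c q n B \<tau>" and "0 \<le> c" "0 \<le> q" "q \<le> 1" "0 < n" "height \<tau> \<le> t"
    and sat: "\<And>v. v \<in> verts \<tau> \<Longrightarrow> depth \<tau> v < t \<Longrightarrow> weight c n B (verts \<tau>) v = 0"
    and t: "real ((t + 1) ^ D) * q ^ t < 1 / 2"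
  shows "D < rank \<tau>"
proof (rule ccontr)
  assume "\<not> ?thesis"
  then have card: "card (verts \<tau>) \<le> (t + 1) ^ D" using card_verts_le_of_rank[OF assms(6)] by simp
  have "q ^ depth \<tau> v * weight c n B (verts \<tau>) v \<le> q ^ t * n" if "v \<in> verts \<tau>" for v
  proof (cases "depth \<tau> v < t")
    case True
    then show ?thesis using sat[OF that] assms(3) by simp
  next
    case False
    then show ?thesis using assms weight_le[of c] by (intro mult_mono power_decreasing) auto
  qed
  then have "potential c q n B \<tau> \<le> (\<Sum>v\<in>verts \<tau>. q ^ t * n)"
    unfolding potential_def by (intro sum_mono)
  also have "\<dots> = real (card (verts \<tau>)) * q ^ t * n" by simp
  also have "\<dots> \<le> real ((t + 1) ^ D) * q ^ t * n"
    using card assms(3) by (intro mult_right_mono) (auto simp del: of_nat_power)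
  also have "\<dots> < 1 / 2 * n" using t assms(5) by (intro mult_strict_right_mono) auto
  finally show False using pot by simp
qed


section \<open>Choice of constants and Maker's strategy\<close>

lemma power_times_geometric_tendsto_0:
  fixes q :: real
  assumes "0 < q" "q < 1"
  shows "(\<lambda>t. real ((t + 1) ^ D) * q ^ t) \<longlonglongrightarrow> 0"
  using assms by real_asymp

theorem theorem8:
  fixes V :: "'a set" and E :: "'a set set" and \<epsilon> :: real
  assumes "forest V E" and "\<epsilon> > 0"
  shows "\<exists>N::nat. \<forall>n>N. maker_wins_minor_game V E n (nat \<lfloor>(1 - \<epsilon>) * real n\<rfloor>)"
proof -
  \<comment> \<open>The cap at 1/2 handles large \<open>\<epsilon>\<close> and keeps
    \<open>c\<close> at most 1/16; the bias is still at most
    \<open>(1 - \<delta>) * n\<close>.\<close>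
  define \<delta> where "\<delta> = min \<epsilon> (1/2)"
  define c q where "c = \<delta>/8" and "q = 1 - \<delta>/4"
  have \<delta>: "0 < \<delta>" "\<delta> \<le> 1/2" "\<delta> \<le> \<epsilon>" using assms(2) by (auto simp: \<delta>_def)
  then have q: "0 < q" "q < 1" and c: "0 < c" "c \<le> 1/16" by (auto simp: q_def c_def)
  have "\<forall>\<^sub>F t in sequentially. real ((t + 1) ^ card V) * q ^ t < 1/2"
    by (rule order_tendstoD(2)[OF power_times_geometric_tendsto_0[OF q]]) simp
  then obtain t where t: "real ((t + 1) ^ card V) * q ^ t < 1/2"
    by (auto simp: eventually_sequentially)
  \<comment> \<open>\<open>2 ^ t\<close> bounds the size of a tree of height \<open>t\<close>, hence
    the number of rounds for which Maker grows it, independently of \<open>n\<close>.\<close>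
  define s :: real where "s = 2 ^ t"
  have s: "1 \<le> s" by (simp add: s_def)
  \<comment> \<open>The threshold is what \<open>low_degree_vertex\<close> asks for,
    \<open>2 * s \<le> c * c * n\<close>; it also yields \<open>s + 1 \<le> c * n\<close>.\<close>
  have "maker_wins_minor_game V E n (nat \<lfloor>(1 - \<epsilon>) * real n\<rfloor>)" if n: "nat \<lceil>2 * s / (c * c)\<rceil> < n" for n
  proof -
    define b where "b = nat \<lfloor>(1 - \<epsilon>) * real n\<rfloor>"
    have big: "2 * s \<le> c * c * n"
    proof -
      have "2 * s / (c * c) \<le> n" using n by linarith
      then show ?thesis using c by (simp add: field_simps)
    qed
    have small: "s + 1 \<le> c * n"
    proof -
      have "c * (c * n) \<le> 1 * (c * n)" using c by (intro mult_right_mono) auto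
      then show ?thesis using big s by (simp add: mult_ac)
    qed
    have n0: "0 < n" using n by simp
    have bn: "real b \<le> (1 - \<delta>) * n"
    proof (cases "0 \<le> (1 - \<epsilon>) * real n")
      case True
      then have "real b \<le> (1 - \<epsilon>) * n" by (simp add: b_def)
      also have "\<dots> \<le> (1 - \<delta>) * n" using \<delta> by (intro mult_right_mono) auto
      finally show ?thesis .
    next
      case False
      then have "b = 0" by (simp add: b_def)
      then show ?thesis using \<delta> by simp
    qed
    let ?X = "nsets {..<n} 2"
    \<comment> \<open>The tree starts with one vertex and gains one per round, so its size bounds
      the number of Breaker's edges.\<close>
    define tree where "tree h \<tau> \<longleftrightarrow> ltree_in (maker_claimed h) \<tau> \<and> verts \<tau> \<subseteq> {..<n} \<and> height \<tau> \<le> t \<and>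
      \<Union> (maker_claimed h) \<subseteq> verts \<tau> \<and> Suc (length h) = card (verts \<tau>) \<and>
      breaker_claimed h \<subseteq> ?X \<and> card (breaker_claimed h) \<le> length h * b \<and>
      n / 2 \<le> potential c q n (breaker_claimed h) \<tau>" for h :: "nat set history" and \<tau>
    define win where "win h \<longleftrightarrow> is_minor V E {..<n} (maker_claimed h)" for h :: "nat set history"
    have progress: "win h \<or> (\<exists>e\<in>unclaimed ?X h. \<forall>F. F \<subseteq> unclaimed ?X h - {e} \<and> card F \<le> b \<longrightarrow>
        (\<exists>\<tau>'. tree (h @ [(e, F)]) \<tau>'))" if tree: "tree h \<tau>" for h \<tau>
    proof (cases "\<exists>v\<in>verts \<tau>. depth \<tau> v < t \<and> 0 < weight c n (breaker_claimed h) (verts \<tau>) v")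
      case False
      have "card V < rank \<tau>"
      proof (rule rank_of_saturated[where t = t])
        show "n / 2 \<le> potential c q n (breaker_claimed h) \<tau>" "height \<tau> \<le> t"
          using tree by (auto simp: tree_def)
        show "weight c n (breaker_claimed h) (verts \<tau>) v = 0" if "v \<in> verts \<tau>" "depth \<tau> v < t" for v
        proof -
          have "\<not> 0 < weight c n (breaker_claimed h) (verts \<tau>) v" using False that by blast
          then show ?thesis using weight_nonneg[of c n "breaker_claimed h" "verts \<tau>" v] by linarith
        qed
      qed (use q c n0 t in auto)
      then have "win h"
        unfolding win_def using tree by (intro forest_minor_of_ltree[OF assms(1), of _ \<tau>]) (auto simp: tree_def)
      then show ?thesis ..
    next
      case True
      define B L where "B = breaker_claimed h" and "L = verts \<tau>"
      have T: "ltree_in (maker_claimed h) \<tau>" "L \<subseteq> {..<n}" "height \<tau> \<le> t" "\<Union> (maker_claimed h) \<subseteq> L"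
        "Suc (length h) = card L" "B \<subseteq> ?X" "card B \<le> length h * b" "n / 2 \<le> potential c q n B \<tau>"
        using tree by (auto simp: tree_def B_def L_def)
      have cardL: "card L \<le> s"
      proof -
        have "card L \<le> 2 ^ t"
          unfolding L_def by (rule order.trans[OF card_verts_le_power_height power_increasing[OF T(3)]]) simp
        then have "real (card L) \<le> real (2 ^ t)" by (rule of_nat_mono)
        then show ?thesis by (simp add: s_def)
      qed
      define alive where "alive v \<longleftrightarrow> v \<in> L \<and> 0 < weight c n B L v" for v
      \<comment> \<open>Minimal depth is what \<open>potential_after_round\<close> requires; it also
        puts \<open>v\<close> above level \<open>t\<close>, so attaching keeps the height
        bound.\<close>
      define v where "v = arg_min (depth \<tau>) alive"
      obtain v0 where v0: "alive v0" "depth \<tau> v0 < t" using True by (auto simp: alive_def L_def B_def)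
      then have v: "alive v" "\<And>x. alive x \<Longrightarrow> depth \<tau> v \<le> depth \<tau> x"
        unfolding v_def by (auto intro: arg_min_natI arg_min_nat_le)
      then have dv: "depth \<tau> v < t" using v0 by force
      \<comment> \<open>Positive weight gives more than \<open>c * n\<close> candidates, and
        Breaker's at most \<open>s * n\<close> edges cannot give all of them large degree.\<close>
      have "\<exists>u\<in>escapes n B L v. card {y \<in> {..<n}. {u, y} \<in> B} \<le> c * n"
      proof (rule low_degree_vertex[OF T(6)])
        have "real (card B) \<le> real (length h) * real b" using T(7) by (metis of_nat_le_iff of_nat_mult)
        also have "\<dots> \<le> s * n"
        proof (rule mult_mono)
          show "real (length h) \<le> s" using T(5) cardL by linarith
          have "(1 - \<delta>) * n \<le> 1 * real n" using \<delta> by (intro mult_right_mono) auto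
          then show "real b \<le> n" using bn by linarith
        qed (use s in auto)
        finally show "real (card B) \<le> s * n" .
        show "finite (escapes n B L v)" by (simp add: escapes_def)
        show "c * n < card (escapes n B L v)" using v(1) by (auto simp: alive_def weight_def)
      qed (use c n0 big in auto)
      then obtain u where u: "u < n" "u \<notin> L" "{v, u} \<notin> B" "card {y \<in> {..<n}. {u, y} \<in> B} \<le> c * n"
        by (auto simp: escapes_def)
      have vL: "v \<in> L" using v(1) by (simp add: alive_def)
      have "{v, u} \<in> ?X" using vL u T(2) by (auto simp: nsets_def card_insert_if)
      then have e: "{v, u} \<in> unclaimed ?X h"
        using u T(4) by (auto simp: unclaimed_def B_def)
      have "tree (h @ [({v, u}, F)]) (attach v u \<tau>)" if F: "F \<subseteq> unclaimed ?X h - {{v, u}}" "card F \<le> b" for F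
      proof -
        have FX: "F \<subseteq> ?X" using F(1) by (auto simp: unclaimed_def)
        then have finF: "finite F" by (rule finite_subset) (simp add: finite_imp_finite_nsets)
        have vs: "verts (attach v u \<tau>) = insert u L" using vL by (simp add: verts_attach L_def)
        have "potential c q n B \<tau> \<le> potential c q n (B \<union> F) (attach v u \<tau>)"
          unfolding c_def q_def
        proof (rule potential_after_round[OF _ _ T(1)])
          show "depth \<tau> v \<le> depth \<tau> x" if "x \<in> verts \<tau>" "0 < weight (\<delta>/8) n B (verts \<tau>) x" for x
            using v(2)[of x] that by (simp add: alive_def L_def c_def)
          show "card F \<le> (1 - \<delta>) * n" using F(2) bn by linarith
          show "card (verts \<tau>) + 1 \<le> \<delta>/8 * n" using cardL small by (simp add: L_def c_def)
        qed (use \<delta> u vL finF in \<open>auto simp: L_def c_def\<close>)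
        then have "n / 2 \<le> potential c q n (B \<union> F) (attach v u \<tau>)" using T(8) by simp
        moreover have "ltree_in (insert {v, u} (maker_claimed h)) (attach v u \<tau>)"
          using T(1) u(2) by (intro ltree_in_attach) (auto simp: L_def intro: ltree_in_mono)
        moreover have "height (attach v u \<tau>) \<le> t"
          using height_attach[OF T(1) _ dv T(3)] vL by (simp add: L_def)
        moreover have "card (B \<union> F) \<le> Suc (length h) * b"
          using T(7) F(2) card_Un_le[of B F] by simp
        moreover have "finite L" by (simp add: L_def finite_verts)
        ultimately show ?thesis
          unfolding tree_def using T(2,4,5,6) u vL FX by (auto simp: vs B_def[symmetric])
      qed
      then show ?thesis using e by blast
    qed
    have "\<exists>\<sigma>. maker_winning_strategy ?X b (is_minor V E {..<n}) \<sigma>"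
    proof (rule maker_wins_by_invariant[where I = "\<lambda>h. win h \<or> (\<exists>\<tau>. tree h \<tau>)"])
      \<comment> \<open>The initial tree is the vertex 0 with \<open>n - 1\<close> escapes; as
        \<open>c \<le> 1/16\<close> and \<open>n\<close> is large, its weight is at least
        \<open>n / 2\<close>.\<close>
      have "escapes n {} {0} 0 = {..<n} - {0}" by (auto simp: escapes_def)
      then have "real (card (escapes n {} {0} 0)) = n - 1" using n0 by (simp add: of_nat_diff)
      moreover have "c * n \<le> 1/16 * real n" using c by (intro mult_right_mono) auto
      then have "n / 2 \<le> n - 1 - c * n" using small s by linarith
      ultimately have "n / 2 \<le> weight c n {} {0} 0" unfolding weight_def by linarith
      then have "tree [] (Leaf 0)"
        using n0 by (simp add: tree_def maker_claimed_def breaker_claimed_def potential_def)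
      then show "win [] \<or> (\<exists>\<tau>. tree [] \<tau>)" by blast
    next
      fix h assume I: "win h \<or> (\<exists>\<tau>. tree h \<tau>)" and "unclaimed ?X h \<noteq> {}"
      then obtain e where e: "e \<in> unclaimed ?X h" by blast
      show "\<exists>e\<in>unclaimed ?X h. \<forall>F. F \<subseteq> unclaimed ?X h - {e} \<and> card F \<le> b \<longrightarrow>
          win (h @ [(e, F)]) \<or> (\<exists>\<tau>. tree (h @ [(e, F)]) \<tau>)"
      proof (cases "win h")
        case True
        \<comment> \<open>Once present, the minor survives all later moves, so any unclaimed edge
          will do.\<close>
        have "maker_claimed h \<subseteq> maker_claimed (h @ [(e, F)])" for F by auto
        then have "win (h @ [(e, F)])" for F
          using is_minor_mono[OF True[unfolded win_def] _ order.refl] unfolding win_def by blast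
        then show ?thesis using e by (intro bexI[of _ e]) simp_all
      next
        case False
        with I obtain \<tau> where "tree h \<tau>" by blast
        from progress[OF this] False obtain e where "e \<in> unclaimed ?X h"
          "\<forall>F. F \<subseteq> unclaimed ?X h - {e} \<and> card F \<le> b \<longrightarrow> (\<exists>\<tau>'. tree (h @ [(e, F)]) \<tau>')"
          by (elim disjE bexE) simp_all
        then show ?thesis by (intro bexI[of _ e]) simp_all
      qed
    next
      fix h assume "win h \<or> (\<exists>\<tau>. tree h \<tau>)" and "unclaimed ?X h = {}"
      \<comment> \<open>On a full board \<open>progress\<close> cannot supply an unclaimed edge, so
        the minor is already there.\<close>
      then have "win h" using progress[of h] by (elim disjE exE) simp_all
      then show "is_minor V E {..<n} (maker_claimed h)" by (simp add: win_def)
    qed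
    then show ?thesis by (simp add: maker_wins_minor_game_def b_def)
  qed
  then show ?thesis by blast
qed

end
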